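(* For all integers $n\ge 0$, \[ a_{3,1}(n)\ge a_{3,2}(n)\ge a_{3,4}(n). \]
   Context: A partition of $n$ is a non-increasing sequence of positive integers summing to $n$; its Young diagram is the left-justified array of boxes whose $i$-th row has $\lambda_i$ boxes. The hook length of a box is the number of boxes directly to its right, plus the number directly below it, plus $1$; a box of hook length $k$ is a $k$-hook. For $t\ge 2$, a $t$-core partition is a partition none of whose hook lengths is divisible by $t$. $a_{t,k}(n)$ denotes the total number of hooks of length $k$ summed over all $t$-core partitions of $n$. *)

theory Defs
  imports Main
begin

definition is_partition :: "nat \<Rightarrow> nat list \<Rightarrow> bool" where
  "is_partition n xs \<longleftrightarrow> sorted_wrt (\<ge>) xs \<and> (\<forall>x \<in> set xs. 0 < x) \<and> sum_list xs = n"

text \<open>Rows and columns are counted from 0: the box \<open>(i, j)\<close> lies in row \<open>i\<close> and column \<open>j\<close>,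
  with rows running downwards and columns to the right.\<close>

definition young_diagram :: "nat list \<Rightarrow> (nat \<times> nat) set" where
  "young_diagram xs = {(i, j). i < length xs \<and> j < xs ! i}"

definition hook_length :: "nat list \<Rightarrow> nat \<times> nat \<Rightarrow> nat" where
  "hook_length xs b =
     card {j'. snd b < j' \<and> (fst b, j') \<in> young_diagram xs} +
     card {i'. fst b < i' \<and> (i', snd b) \<in> young_diagram xs} + 1"

definition is_core :: "nat \<Rightarrow> nat list \<Rightarrow> bool" where
  "is_core t xs \<longleftrightarrow> (\<forall>b \<in> young_diagram xs. \<not> t dvd hook_length xs b)"

definition num_hooks :: "nat \<Rightarrow> nat list \<Rightarrow> nat" where
  "num_hooks k xs = card {b \<in> young_diagram xs. hook_length xs b = k}"

definition core_hooks :: "nat \<Rightarrow> nat \<Rightarrow> nat \<Rightarrow> nat" where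
  "core_hooks t k n = (\<Sum>xs \<in> {xs. is_partition n xs \<and> is_core t xs}. num_hooks k xs)"

text \<open>The index set of the sum and the sets whose cardinalities are taken are finite, so the
  conventions for sums over and cardinalities of infinite sets play no role above.\<close>

lemma finite_young_diagram: "finite (young_diagram xs)"
proof -
  have "young_diagram xs = (SIGMA i:{..<length xs}. {..<xs ! i})"
    by (auto simp: young_diagram_def)
  then show ?thesis by simp
qed

lemma finite_hook_arm: "finite {j'. j < j' \<and> (i, j') \<in> young_diagram xs}"
  by (rule finite_subset[OF _ finite_imageI[OF finite_young_diagram[of xs], of snd]]) force

lemma finite_hook_leg: "finite {i'. i < i' \<and> (i', j) \<in> young_diagram xs}"
  by (rule finite_subset[OF _ finite_imageI[OF finite_young_diagram[of xs], of fst]]) force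

lemma finite_partitions: "finite {xs. is_partition n xs}"
proof (rule finite_subset)
  have len: "length xs \<le> sum_list xs" if "\<forall>x \<in> set xs. 0 < x" for xs :: "nat list"
    using that by (induction xs) auto
  show "{xs. is_partition n xs} \<subseteq> {xs. set xs \<subseteq> {..n} \<and> length xs \<le> n}"
    using len by (auto simp: is_partition_def intro: member_le_sum_list)
  show "finite {xs. set xs \<subseteq> {..n} \<and> length xs \<le> n}"
    by (rule finite_lists_length_le) simp
qed

lemma finite_core_partitions: "finite {xs. is_partition n xs \<and> is_core t xs}"
  by (rule finite_subset[OF _ finite_partitions[of n]]) auto

end

theory Submission
  imports Defs
begin

text \<open>Encode a partition by its beta-set \<open>B\<close>, the set of hook lengths in the first column. Hooks of
  length \<open>k\<close> correspond to the \<open>x \<in> B\<close> with \<open>x \<ge> k\<close> and \<open>x - k \<notin> B\<close>, so a partition is a 3-core iff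
  \<open>B\<close> is closed under subtracting 3. For such \<open>B\<close> both inequalities hold for every single core:
  if \<open>x - 2 \<notin> B\<close>, then moving down from \<open>x\<close> in one or two steps of size 1 must leave \<open>B\<close>, and the
  closure under subtracting 3 makes the choice of the leaving step injective. The same works with 4
  and 2 in place of 2 and 1.\<close>

lemma down_closed_eq_lessThan_card:
  fixes S :: "nat set"
  assumes "finite S" and "\<And>i j. j \<in> S \<Longrightarrow> i \<le> j \<Longrightarrow> i \<in> S"
  shows "S = {..<card S}"
proof (cases "S = {}")
  case False
  then have "S = {..Max S}"
    using assms by (auto intro: Max_in)
  then show ?thesis
    by (metis card_atMost lessThan_Suc_atMost)
qed simp

section \<open>Beta-sets, column lengths and gaps\<close>

definition beta :: "nat list \<Rightarrow> nat \<Rightarrow> nat" where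
  "beta xs i = xs ! i + (length xs - Suc i)"

definition beta_set :: "nat list \<Rightarrow> nat set" where
  "beta_set xs = beta xs ` {..<length xs}"

definition col_length :: "nat list \<Rightarrow> nat \<Rightarrow> nat" where
  "col_length xs j = card {i. (i, j) \<in> young_diagram xs}"

text \<open>The numbers \<open>gap xs 0 < gap xs 1 < \<dots>\<close> enumerate the complement of the beta-set.\<close>

definition gap :: "nat list \<Rightarrow> nat \<Rightarrow> nat" where
  "gap xs j = length xs + j - col_length xs j"

definition shifts :: "nat \<Rightarrow> nat set \<Rightarrow> nat set" where
  "shifts k B = {x \<in> B. k \<le> x \<and> x - k \<notin> B}"

context
  fixes xs :: "nat list"
  assumes sorted: "sorted_wrt (\<ge>) xs"
begin

lemma nth_antimono: "i \<le> j \<Longrightarrow> j < length xs \<Longrightarrow> xs ! j \<le> xs ! i"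
  using sorted by (cases "i = j") (auto simp: sorted_wrt_iff_nth_less)

text \<open>As rows weakly decrease, every column of the diagram is an initial segment of the
  rows.\<close>

lemma less_col_length_iff: "i < col_length xs j \<longleftrightarrow> (i, j) \<in> young_diagram xs"
proof -
  have "{i. (i, j) \<in> young_diagram xs} = {..<col_length xs j}"
    unfolding col_length_def
  proof (rule down_closed_eq_lessThan_card)
    show "finite {i. (i, j) \<in> young_diagram xs}"
      by (rule finite_subset[of _ "{..<length xs}"]) (auto simp: young_diagram_def)
  next
    fix i i' assume "i' \<in> {i. (i, j) \<in> young_diagram xs}" "i \<le> i'"
    then show "i \<in> {i. (i, j) \<in> young_diagram xs}"
      using nth_antimono[of i i'] by (auto simp: young_diagram_def)
  qed
  then show ?thesis by blast
qed

lemma col_length_le: "col_length xs j \<le> length xs"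
  using less_col_length_iff[of "length xs" j] by (simp add: young_diagram_def not_less)

lemma col_length_antimono: "j \<le> j' \<Longrightarrow> col_length xs j' \<le> col_length xs j"
  using less_col_length_iff[of "col_length xs j" j] less_col_length_iff[of "col_length xs j" j']
  by (auto simp: young_diagram_def not_less)

text \<open>Arm and leg are read off from \<open>xs ! i\<close> and \<open>col_length xs j\<close>;
  the two occurrences of \<open>length xs\<close> cancel in the difference of
  \<open>beta xs i\<close> and \<open>gap xs j\<close>.\<close>

lemma hook_length_add_gap:
  assumes "(i, j) \<in> young_diagram xs"
  shows "hook_length xs (i, j) + gap xs j = beta xs i"
proof -
  have ij: "i < length xs" "j < xs ! i"
    using assms by (auto simp: young_diagram_def)
  have "{j'. j < j' \<and> (i, j') \<in> young_diagram xs} = {j<..<xs ! i}"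
    using ij by (auto simp: young_diagram_def)
  moreover have "{i'. i < i' \<and> (i', j) \<in> young_diagram xs} = {i<..<col_length xs j}"
    by (auto simp: less_col_length_iff)
  ultimately have "hook_length xs (i, j) = (xs ! i - Suc j) + (col_length xs j - Suc i) + 1"
    by (simp add: hook_length_def)
  moreover have "i < col_length xs j"
    using assms by (simp add: less_col_length_iff)
  ultimately show ?thesis
    using ij col_length_le[of j] by (simp add: gap_def beta_def)
qed

lemma beta_less: "i < j \<Longrightarrow> j < length xs \<Longrightarrow> beta xs j < beta xs i"
  using nth_antimono[of i j] by (simp add: beta_def)

lemma inj_on_beta: "inj_on (beta xs) {..<length xs}"
  by (rule linorder_inj_onI) (auto dest: beta_less)

lemma strict_mono_gap: "strict_mono (gap xs)"
proof (rule strict_monoI)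
  fix i j :: nat assume "i < j"
  then show "gap xs i < gap xs j"
    using col_length_antimono[of i j] col_length_le[of i] by (simp add: gap_def)
qed

lemma gap_less_beta_iff:
  assumes "i < length xs"
  shows "gap xs j < beta xs i \<longleftrightarrow> (i, j) \<in> young_diagram xs"
proof (cases "i < col_length xs j")
  case True
  then show ?thesis
    using assms col_length_le[of j] less_col_length_iff[of i j]
    by (auto simp: gap_def beta_def young_diagram_def)
next
  case False
  then show ?thesis
    using assms col_length_le[of j] less_col_length_iff[of i j]
    by (auto simp: gap_def beta_def young_diagram_def)
qed

lemma gap_notin_beta_set: "gap xs j \<notin> beta_set xs"
proof
  assume "gap xs j \<in> beta_set xs"
  then obtain i where i: "i < length xs" "gap xs j = beta xs i"
    by (auto simp: beta_set_def)
  then have "\<not> i < col_length xs j" "\<not> j < xs ! i"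
    using gap_less_beta_iff[of i j] less_col_length_iff[of i j] by (auto simp: young_diagram_def)
  \<comment> \<open>Outside the diagram \<open>xs ! i\<close> \<le> \<open>j\<close> and
    \<open>col_length xs j\<close> \<le> \<open>i\<close>, which makes \<open>beta xs i\<close>
    strictly smaller than \<open>gap xs j\<close>.\<close>
  then show False
    using i col_length_le[of j] by (simp add: gap_def beta_def)
qed

text \<open>Squeeze \<open>y\<close> between two consecutive gaps. Positive parts make the first
  column full, so the gaps start at 0 and some gap is at most \<open>y\<close>.\<close>

lemma notin_beta_set_imp_gap:
  assumes pos: "\<forall>x \<in> set xs. 0 < x" and y: "y \<notin> beta_set xs"
  obtains j where "y = gap xs j"
proof -
  have gap_0: "gap xs 0 = 0"
    using pos less_col_length_iff[of "length xs - 1" 0] by (cases xs rule: rev_cases)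
      (auto simp: gap_def young_diagram_def)
  define j where "j = (GREATEST j. gap xs j \<le> y)"
  have bound: "\<forall>j. gap xs j \<le> y \<longrightarrow> j \<le> y"
    using strict_mono_imp_increasing[OF strict_mono_gap] le_trans by blast
  have le: "gap xs j \<le> y"
    unfolding j_def by (rule GreatestI_nat[where k = 0 and b = y]) (use gap_0 bound in auto)
  have gt: "y < gap xs (Suc j)"
    using Greatest_le_nat[of "\<lambda>j. gap xs j \<le> y" "Suc j" y] bound unfolding j_def
    by (meson not_less not_less_eq_eq order_refl)
  have "y = gap xs j"
  proof (rule ccontr)
    assume "y \<noteq> gap xs j"
    with le have less: "gap xs j < y" by simp
    \<comment> \<open>The numbers strictly between two consecutive gaps come from the rows of length \<open>j + 1\<close>.\<close>
    define i where "i = length xs + j - y"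
    \<comment> \<open>The bounds on \<open>y\<close> say that row \<open>i\<close> reaches column
      \<open>j\<close> but not column \<open>Suc j\<close>.\<close>
    have i: "i < col_length xs j" "\<not> i < col_length xs (Suc j)" "i + y = length xs + j"
      using less gt col_length_le[of j] col_length_le[of "Suc j"] by (auto simp: i_def gap_def)
    then have "i < length xs" "xs ! i = Suc j"
      unfolding less_col_length_iff by (auto simp: young_diagram_def)
    then have "beta xs i = y"
      using i by (simp add: beta_def)
    with y \<open>i < length xs\<close> show False
      by (auto simp: beta_set_def)
  qed
  then show ?thesis by (rule that)
qed

section \<open>Hooks as moves out of the beta-set\<close>

text \<open>A box \<open>(i, j)\<close> of hook length \<open>k\<close> is the move from
  \<open>beta xs i\<close> down to \<open>gap xs j\<close>. The start determines the row, the end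
  the column, since \<open>beta xs\<close> and \<open>gap xs\<close> are injective.\<close>

lemma bij_betw_hooks_shifts:
  assumes pos: "\<forall>x \<in> set xs. 0 < x" and "0 < k"
  shows "bij_betw (\<lambda>b. beta xs (fst b)) {b \<in> young_diagram xs. hook_length xs b = k}
    (shifts k (beta_set xs))"
proof (rule bij_betw_imageI)
  show "inj_on (\<lambda>b. beta xs (fst b)) {b \<in> young_diagram xs. hook_length xs b = k}"
  proof (rule inj_onI, clarify)
    fix i j i' j'
    assume *: "(i, j) \<in> young_diagram xs" "(i', j') \<in> young_diagram xs"
      "beta xs (fst (i, j)) = beta xs (fst (i', j'))" "k = hook_length xs (i, j)"
      "hook_length xs (i', j') = hook_length xs (i, j)"
    then have "gap xs j = gap xs j'"
      using hook_length_add_gap[of i j] hook_length_add_gap[of i' j'] by simp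
    moreover have "i = i'"
      using *(1-3) inj_onD[OF inj_on_beta, of i i'] by (simp add: young_diagram_def)
    ultimately show "i = i' \<and> j = j'"
      by (simp add: strict_mono_eq[OF strict_mono_gap])
  qed
  show "(\<lambda>b. beta xs (fst b)) ` {b \<in> young_diagram xs. hook_length xs b = k}
    = shifts k (beta_set xs)"
  proof (intro equalityI subsetI)
    fix x assume "x \<in> (\<lambda>b. beta xs (fst b)) ` {b \<in> young_diagram xs. hook_length xs b = k}"
    then obtain i j where *: "(i, j) \<in> young_diagram xs" "hook_length xs (i, j) = k" "x = beta xs i"
      by auto
    then have "k + gap xs j = x"
      using hook_length_add_gap by blast
    moreover have "x \<in> beta_set xs"
      using * by (auto simp: beta_set_def young_diagram_def)
    ultimately show "x \<in> shifts k (beta_set xs)"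
      using gap_notin_beta_set[of j] by (auto simp: shifts_def)
  next
    fix x assume "x \<in> shifts k (beta_set xs)"
    then obtain i where *: "i < length xs" "x = beta xs i" "k \<le> x" "x - k \<notin> beta_set xs"
      by (auto simp: shifts_def beta_set_def)
    obtain j where j: "x - k = gap xs j"
      using notin_beta_set_imp_gap[OF pos *(4)] .
    with * \<open>0 < k\<close> have "gap xs j < beta xs i" "k + gap xs j = beta xs i"
      by linarith+
    moreover from this have "(i, j) \<in> young_diagram xs"
      using gap_less_beta_iff[OF *(1)] by blast
    moreover from this have "hook_length xs (i, j) + gap xs j = beta xs i"
      by (rule hook_length_add_gap)
    ultimately have "(i, j) \<in> young_diagram xs" "hook_length xs (i, j) = k"
      by simp_all
    then show "x \<in> (\<lambda>b. beta xs (fst b)) ` {b \<in> young_diagram xs. hook_length xs b = k}"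
      using * by (intro image_eqI[where x = "(i, j)"]) auto
  qed
qed

lemma num_hooks_eq_card_shifts:
  "\<forall>x \<in> set xs. 0 < x \<Longrightarrow> 0 < k \<Longrightarrow> num_hooks k xs = card (shifts k (beta_set xs))"
  unfolding num_hooks_def by (rule bij_betw_same_card[OF bij_betw_hooks_shifts])

lemma core_imp_shifts_empty:
  assumes "\<forall>x \<in> set xs. 0 < x" and "is_core t xs" and "0 < t"
  shows "shifts t (beta_set xs) = {}"
proof -
  have "{b \<in> young_diagram xs. hook_length xs b = t} = {}"
    using assms by (auto simp: is_core_def)
  with bij_betw_hooks_shifts[OF assms(1,3)] show ?thesis
    by (simp add: bij_betw_def)
qed

end

section \<open>Comparing moves by \<open>2 * k\<close> with moves by \<open>k\<close>\<close>

lemma card_shifts_double_le: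
  assumes "finite B"
    and no_collision: "\<And>x. x \<in> B \<Longrightarrow> x + k \<in> B \<Longrightarrow> 2 * k \<le> x \<Longrightarrow> x - 2 * k \<notin> B \<Longrightarrow> x - k \<in> B"
  shows "card (shifts (2 * k) B) \<le> card (shifts k B)"
proof (rule card_inj_on_le)
  \<comment> \<open>On the path \<open>x\<close>, \<open>x - k\<close>, \<open>x - 2 * k\<close>
    this picks the last point still in \<open>B\<close>.\<close>
  let ?f = "\<lambda>x. if x - k \<in> B then x - k else x"
  show "inj_on ?f (shifts (2 * k) B)"
  proof (rule inj_onI)
    \<comment> \<open>Two images can only coincide when \<open>x\<close> stays fixed and
      \<open>y = x + k\<close> moves down to \<open>x\<close>; \<open>no_collision\<close> then puts
      \<open>x - k\<close> into \<open>B\<close>.\<close>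
    have collision: False
      if "x \<in> shifts (2 * k) B" "y \<in> shifts (2 * k) B" "x - k \<notin> B" "y - k = x" for x y
      using that no_collision[of x] by (auto simp: shifts_def)
    fix x y
    assume xy: "x \<in> shifts (2 * k) B" "y \<in> shifts (2 * k) B" and eq: "?f x = ?f y"
    have le: "k \<le> x" "k \<le> y"
      using xy by (simp_all add: shifts_def)
    consider "x - k \<in> B" "y - k \<in> B" | "x - k \<notin> B" "y - k \<in> B" | "x - k \<in> B" "y - k \<notin> B"
      | "x - k \<notin> B" "y - k \<notin> B" by blast
    then show "x = y"
    proof cases
      case 1
      then have "x - k = y - k" using eq by (simp only: if_True)
      with le show ?thesis by linarith
    next
      case 2
      then have "y - k = x" using eq by (simp only: if_True if_False)
      with collision xy 2 show ?thesis by blast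
    next
      case 3
      then have "x - k = y" using eq by (simp only: if_True if_False)
      with collision xy 3 show ?thesis by blast
    next
      case 4
      then show ?thesis using eq by (simp only: if_False)
    qed
  qed
  show "?f ` shifts (2 * k) B \<subseteq> shifts k B"
    by (auto simp: shifts_def mult_2)
  show "finite (shifts k B)"
    using \<open>finite B\<close> by (simp add: shifts_def)
qed

lemma three_core_num_hooks:
  assumes part: "is_partition n xs" and core: "is_core 3 xs"
  shows "num_hooks 2 xs \<le> num_hooks 1 xs" and "num_hooks 4 xs \<le> num_hooks 2 xs"
proof -
  let ?B = "beta_set xs"
  have xs: "sorted_wrt (\<ge>) xs" "\<forall>x \<in> set xs. 0 < x"
    using part by (auto simp: is_partition_def)
  have sub3: "x - 3 \<in> ?B" if "x \<in> ?B" "3 \<le> x" for x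
    using core_imp_shifts_empty[OF xs core] that by (auto simp: shifts_def)
  have fin: "finite ?B" by (simp add: beta_set_def)
  have "card (shifts (2 * 1) ?B) \<le> card (shifts 1 ?B)"
  proof (rule card_shifts_double_le[OF fin])
    fix x assume "x + 1 \<in> ?B" "2 * 1 \<le> x" "x - 2 * 1 \<notin> ?B"
    \<comment> \<open>The assumptions are contradictory: \<open>x + 1 - 3\<close> is
      \<open>x - 2\<close>.\<close>
    then show "x - 1 \<in> ?B"
      using sub3[of "x + 1"] by simp
  qed
  then show "num_hooks 2 xs \<le> num_hooks 1 xs"
    by (simp add: num_hooks_eq_card_shifts[OF xs])
  have "card (shifts (2 * 2) ?B) \<le> card (shifts 2 ?B)"
  proof (rule card_shifts_double_le[OF fin])
    fix x assume x: "x + 2 \<in> ?B" "2 * 2 \<le> x" "x - 2 * 2 \<notin> ?B"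
    \<comment> \<open>Again contradictory: subtracting 3 twice from \<open>x + 2\<close> reaches
      \<open>x - 4\<close>.\<close>
    then have "x - 1 \<in> ?B" "3 \<le> x - 1" "x - 1 - 3 = x - 4"
      using sub3[of "x + 2"] by auto
    with sub3[of "x - 1"] x show "x - 2 \<in> ?B"
      by simp
  qed
  then show "num_hooks 4 xs \<le> num_hooks 2 xs"
    by (simp add: num_hooks_eq_card_shifts[OF xs])
qed

theorem theorem1p3:
  fixes n :: nat
  shows "core_hooks 3 1 n \<ge> core_hooks 3 2 n \<and> core_hooks 3 2 n \<ge> core_hooks 3 4 n"
  unfolding core_hooks_def using three_core_num_hooks by (intro conjI sum_mono) blast+

end
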